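(* Run Free-SVRG (described in the context) with single uniformly sampled elements (that is, $b$-nice sampling with $b=1$), inner-loop length $m\ge1$ and step size $\alpha=\frac1{6L_{\max}}$. Let $0<\epsilon\le1$. If $$m\in\left[\min\left(n,\tfrac{L_{\max}}\mu\right),\ \max\left(n,\tfrac{L_{\max}}\mu\right)\right],$$ then the total complexity $C_m(1)=2\left(\frac nm+2\right)\max\left\{\frac{3L_{\max}}{\mu},m\right\}\log\left(\frac1\epsilon\right)$ of reaching $\mathbb E\|x_s^m-x^*\|_2^2\le\epsilon\,\phi_0$ satisfies $$C_m(1)\le18\left(n+\frac{L_{\max}}\mu\right)\log\left(\frac1\epsilon\right).$$ In particular, $\mathbb E\|x_s^m-x^*\|_2^2\le\epsilon\,\phi_0$ for every integer $s\ge0$ whose number of gradient evaluations satisfies $s(n+2m)\ge18\left(n+\frac{L_{\max}}\mu\right)\log\left(\frac1\epsilon\right)$. Here $\phi_0=\|x_0^m-x^*\|_2^2+8\alpha^2L_{\max}S_m(f(w_0)-f(x^* ))$.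
   Context: Setting: $n\ge2$, $f(x)=\frac1n\sum_{i=1}^n f_i(x)$ on $\mathbb R^d$ with minimizer $x^*$; $f$ is $L$-smooth, i.e. $f(x)\le f(y)+\langle\nabla f(y),x-y\rangle+\frac L2\|x-y\|_2^2$, and $\mu$-strongly convex with $\mu>0$, i.e. $f(x)\le f(y)+\langle\nabla f(x),x-y\rangle-\frac\mu2\|x-y\|_2^2$, for all $x,y$. Each $f_i$ is differentiable, convex and $L_i$-smooth; $L_{\max}=\max_iL_i$. Notation: $S_m=\sum_{i=0}^{m-1}(1-\alpha\mu)^{m-1-i}$ and $p_t=\frac{(1-\alpha\mu)^{m-1-t}}{S_m}$ for $t=0,\dots,m-1$. Free-SVRG with $b=1$: initialize $w_0=x_0^m\in\mathbb R^d$ (deterministic). For $s=1,2,\dots$: set $x_s^0=x_{s-1}^m$; for $t=0,\dots,m-1$, sample an index $i$ uniformly from $\{1,\dots,n\}$ independently of the past, set $g_s^t=\nabla f_i(x_s^t)-\nabla f_i(w_{s-1})+\nabla f(w_{s-1})$ and $x_s^{t+1}=x_s^t-\alpha g_s^t$; then set $w_s=\sum_{t=0}^{m-1}p_tx_s^t$. Each outer iteration costs $n+2m$ evaluations of individual gradients $\nabla f_i$; the total complexity is the number of such evaluations. *)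

theory Defs
  imports "HOL-Probability.Probability"
begin

text \<open>The value is meaningful only at points of differentiability, where the vector is unique.\<close>

definition gradient :: "('a::euclidean_space \<Rightarrow> real) \<Rightarrow> 'a \<Rightarrow> 'a" where
  "gradient f x = (THE D. GDERIV f x :> D)"

definition smooth_with :: "real \<Rightarrow> ('a::euclidean_space \<Rightarrow> real) \<Rightarrow> bool" where
  "smooth_with L f \<longleftrightarrow>
     (\<forall>x y. f x \<le> f y + gradient f y \<bullet> (x - y) + L / 2 * (norm (x - y))\<^sup>2)"

definition strongly_convex_with :: "real \<Rightarrow> ('a::euclidean_space \<Rightarrow> real) \<Rightarrow> bool" where
  "strongly_convex_with \<mu> f \<longleftrightarrow>
     (\<forall>x y. f x \<le> f y + gradient f x \<bullet> (x - y) - \<mu> / 2 * (norm (x - y))\<^sup>2)"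

definition average :: "nat \<Rightarrow> (nat \<Rightarrow> 'a::euclidean_space \<Rightarrow> real) \<Rightarrow> 'a \<Rightarrow> real" where
  "average n f x = (\<Sum>i=1..n. f i x) / real n"

definition S_weight :: "real \<Rightarrow> real \<Rightarrow> nat \<Rightarrow> real" where
  "S_weight \<alpha> \<mu> m = (\<Sum>i<m. (1 - \<alpha> * \<mu>) ^ (m - 1 - i))"

definition p_weight :: "real \<Rightarrow> real \<Rightarrow> nat \<Rightarrow> nat \<Rightarrow> real" where
  "p_weight \<alpha> \<mu> m t = (1 - \<alpha> * \<mu>) ^ (m - 1 - t) / S_weight \<alpha> \<mu> m"

text \<open>The inner loop started at \<open>x\<close> with reference point \<open>w\<close>; step \<open>t\<close> uses the index \<open>j t\<close>.\<close>

primrec inner_loop ::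
    "nat \<Rightarrow> (nat \<Rightarrow> 'a::euclidean_space \<Rightarrow> real) \<Rightarrow> real \<Rightarrow> (nat \<Rightarrow> nat) \<Rightarrow> 'a \<Rightarrow> 'a \<Rightarrow> nat \<Rightarrow> 'a" where
  "inner_loop n f \<alpha> j w x 0 = x"
| "inner_loop n f \<alpha> j w x (Suc t) =
     (let y = inner_loop n f \<alpha> j w x t;
          g = gradient (f (j t)) y - gradient (f (j t)) w + gradient (average n f) w
      in y - \<alpha> *\<^sub>R g)"

text \<open>
  The pair \<open>(x\<^sub>s\<^sup>m, w\<^sub>s)\<close> after \<open>s\<close> outer iterations, along a fixed realisation \<open>j\<close> of the sampled
  indices: \<open>j s t\<close> (\<open>s \<ge> 1\<close>, \<open>t < m\<close>) is the index used in inner step \<open>t\<close> of outer iteration \<open>s\<close>.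
\<close>

primrec free_svrg ::
    "nat \<Rightarrow> (nat \<Rightarrow> 'a::euclidean_space \<Rightarrow> real) \<Rightarrow> real \<Rightarrow> real \<Rightarrow> nat \<Rightarrow> 'a \<Rightarrow>
     (nat \<Rightarrow> nat \<Rightarrow> nat) \<Rightarrow> nat \<Rightarrow> 'a \<times> 'a" where
  "free_svrg n f \<alpha> \<mu> m x0 j 0 = (x0, x0)"
| "free_svrg n f \<alpha> \<mu> m x0 j (Suc s) =
     (let (x, w) = free_svrg n f \<alpha> \<mu> m x0 j s;
          y = inner_loop n f \<alpha> (j (Suc s)) w x
      in (y m, \<Sum>t<m. p_weight \<alpha> \<mu> m t *\<^sub>R y t))"

text \<open>
  Evaluations of individual gradients in \<open>s\<close> outer iterations: each one takes \<open>n\<close> for the full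
  gradient at the reference point and two per inner step.
\<close>

definition gradient_evals :: "nat \<Rightarrow> nat \<Rightarrow> nat \<Rightarrow> nat" where
  "gradient_evals n m s = s * (n + 2 * m)"

definition total_complexity :: "nat \<Rightarrow> real \<Rightarrow> real \<Rightarrow> nat \<Rightarrow> real \<Rightarrow> real" where
  "total_complexity n Lmax \<mu> m \<epsilon> =
     2 * (real n / real m + 2) * max (3 * Lmax / \<mu>) (real m) * ln (1 / \<epsilon>)"

text \<open>
  The draws are independent and uniform on \<open>{1..n}\<close>; joint independence of all draws that are
  used expresses that each index is sampled independently of the past.
\<close>

definition uniform_index_draws :: "'w measure \<Rightarrow> nat \<Rightarrow> nat \<Rightarrow> (nat \<Rightarrow> nat \<Rightarrow> 'w \<Rightarrow> nat) \<Rightarrow> bool" where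
  "uniform_index_draws M n m J \<longleftrightarrow>
     prob_space.indep_vars M (\<lambda>_. count_space {1..n}) (\<lambda>(s, t). J s t) ({1..} \<times> {..<m}) \<and>
     (\<forall>s\<ge>1. \<forall>t<m. distr M (count_space {1..n}) (J s t) = uniform_count_measure {1..n})"

end

theory Submission imports Defs begin

text \<open>
  Write \<open>F\<close> for the average, \<open>gap x = F x - F xstar\<close>, and let \<open>\<alpha> Lmax \<le> 1/6\<close>.  One inner step from \<open>y\<close> with
  reference point \<open>w\<close> satisfies, on average over the drawn index,
  \<open>E |y' - xstar|\<^sup>2 \<le> (1 - \<alpha>\<mu>) |y - xstar|\<^sup>2 - 2\<alpha>(1 - 2\<alpha> Lmax) gap y + 4\<alpha>\<^sup>2 Lmax gap w\<close>:
  the direction is an unbiased estimate of the gradient of \<open>F\<close> at \<open>y\<close>, so strong convexity bounds the cross term, and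
  its second moment is at most \<open>4Lmax (gap y + gap w)\<close> because for convex smooth \<open>f i\<close> the squared
  distance of two gradients is controlled by a Bregman gap
  (\<open>gradient_diff_le_bregman\<close>, \<open>sum_norm_svrg_direction_le\<close>, \<open>mean_sq_dist_step_le\<close>).

  Unrolling this recursion over the inner loop weights the gaps at step \<open>t\<close> by
  \<open>(1 - \<alpha>\<mu>)^(m - 1 - t)\<close>, which are, up to the factor \<open>S_weight\<close>, exactly the averaging weights that
  define the next reference point.  By Jensen's inequality the unrolled sum dominates
  \<open>S_weight\<close> times the gap at that point, and the Lyapunov function
  \<open>|x - xstar|\<^sup>2 + 8\<alpha>\<^sup>2 Lmax S_weight gap w\<close> contracts in expectation by the factor
  \<open>max ((1 - \<alpha>\<mu>)^m) (1/2)\<close> per outer iteration (\<open>expectation_lyapunov_contracts\<close>).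

  The iterates before a step are functions of finitely many draws with finitely many values.  So
  all integrands are bounded, and averaging over the next, independent draw takes the place of a
  conditional expectation (\<open>expectation_fresh_uniform_draw\<close>).

  With \<open>\<alpha> = 1/(6Lmax)\<close> the two entries of the maximum are at most \<open>exp (-m\<mu>/(6Lmax))\<close> and
  \<open>exp (-1/2)\<close>.  Hence \<open>s \<ge> (2/m) max (3Lmax/\<mu>) m ln (1/\<epsilon>)\<close> outer iterations suffice, and multiplying
  by the cost \<open>n + 2m\<close> of an iteration gives the total complexity.  Its bound is arithmetic, from
  \<open>n \<sqdot> Lmax/\<mu> = min \<sqdot> max \<le> m \<sqdot> max\<close>, where min and max are those of \<open>n\<close> and \<open>Lmax/\<mu>\<close>.
\<close>

section \<open>Gradients\<close>

lemma gderiv_gradient: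
  fixes f :: "'a::euclidean_space \<Rightarrow> real"
  assumes "f differentiable (at x)"
  shows "GDERIV f x :> gradient f x"
proof -
  obtain f' where f': "(f has_derivative f') (at x)"
    using assms by (auto simp: differentiable_def)
  interpret bounded_linear f' by (rule has_derivative_bounded_linear[OF f'])
  define D where "D = (\<Sum>b\<in>Basis. f' b *\<^sub>R b)"
  have "f' h = h \<bullet> D" for h
  proof -
    have "f' h = f' (\<Sum>b\<in>Basis. (h \<bullet> b) *\<^sub>R b)" by (simp add: euclidean_representation)
    also have "\<dots> = h \<bullet> D" by (simp add: sum scaleR D_def inner_sum_right mult.commute)
    finally show ?thesis .
  qed
  hence D: "GDERIV f x :> D" using f' unfolding gderiv_def by (metis (no_types, lifting) ext)
  have "D' = D" if "GDERIV f x :> D'" for D'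
  proof -
    have "(\<lambda>h. h \<bullet> D') = (\<lambda>h. h \<bullet> D)"
      using that D unfolding gderiv_def by (rule has_derivative_unique)
    thus ?thesis by (metis vector_eq_rdot inner_commute)
  qed
  with D show ?thesis unfolding gradient_def by (metis theI)
qed

lemma gradient_eqI:
  fixes f :: "'a::euclidean_space \<Rightarrow> real"
  assumes "GDERIV f x :> D"
  shows "gradient f x = D"
proof -
  have "f differentiable (at x)"
    using assms unfolding gderiv_def differentiable_def by blast
  hence "(\<lambda>h. h \<bullet> gradient f x) = (\<lambda>h. h \<bullet> D)"
    using gderiv_gradient assms unfolding gderiv_def by (blast intro: has_derivative_unique)
  thus ?thesis by (metis vector_eq_rdot inner_commute)
qed

lemma gderiv_average:
  assumes "\<And>i. i \<in> {1..n} \<Longrightarrow> f i differentiable (at x)"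
  shows "GDERIV (average n f) x :> (\<Sum>i=1..n. gradient (f i) x) /\<^sub>R real n"
proof -
  have "(f i has_derivative (\<lambda>h. h \<bullet> gradient (f i) x)) (at x)" if "i \<in> {1..n}" for i
    using gderiv_gradient[OF assms[OF that]] by (simp add: gderiv_def)
  hence "((\<lambda>x. (\<Sum>i=1..n. f i x) / real n) has_derivative
          (\<lambda>h. (\<Sum>i=1..n. h \<bullet> gradient (f i) x) / real n)) (at x)"
    by (auto intro!: derivative_eq_intros simp: divide_inverse)
  thus ?thesis
    by (simp add: gderiv_def average_def[abs_def] inner_sum_right divide_inverse mult.commute)
qed

text \<open>Restricting to the line through the two points reduces the claim to the tangent inequality
  for convex functions of one real variable.\<close>

lemma convex_on_above_gradient:
  fixes f :: "'a::euclidean_space \<Rightarrow> real"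
  assumes conv: "convex_on UNIV f" and diff: "f differentiable (at y)"
  shows "f y + gradient f y \<bullet> (x - y) \<le> f x"
proof -
  define g where "g = (\<lambda>t::real. f (y + t *\<^sub>R (x - y)))"
  have "convex_on UNIV g"
  proof (rule convex_onI)
    fix t a b :: real assume t: "0 < t" "t < 1"
    have "y + ((1 - t) * a + t * b) *\<^sub>R (x - y)
        = (1 - t) *\<^sub>R (y + a *\<^sub>R (x - y)) + t *\<^sub>R (y + b *\<^sub>R (x - y))"
      by (simp add: algebra_simps)
    thus "g ((1 - t) *\<^sub>R a + t *\<^sub>R b) \<le> (1 - t) * g a + t * g b"
      unfolding g_def using convex_onD[OF conv, of t] t by simp
  qed auto
  moreover have "(g has_real_derivative gradient f y \<bullet> (x - y)) (at 0)"
  proof -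
    have "(f has_derivative (\<lambda>h. h \<bullet> gradient f y)) (at (y + 0 *\<^sub>R (x - y)))"
      using gderiv_gradient[OF diff] by (simp add: gderiv_def)
    moreover have "((\<lambda>t. y + t *\<^sub>R (x - y)) has_derivative (\<lambda>t. t *\<^sub>R (x - y))) (at 0)"
      by (auto intro!: derivative_eq_intros)
    ultimately have "(g has_derivative (\<lambda>t. (t *\<^sub>R (x - y)) \<bullet> gradient f y)) (at 0)"
      unfolding g_def by (rule has_derivative_compose[rotated])
    thus ?thesis
      by (simp add: has_field_derivative_def inner_commute mult.commute[of _ "gradient f y \<bullet> (x - y)"])
  qed
  ultimately have "g 1 - g 0 \<ge> (gradient f y \<bullet> (x - y)) * (1 - 0)"
    by (intro convex_on_imp_above_tangent[of UNIV g]) auto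
  thus ?thesis by (simp add: g_def)
qed

lemma gradient_zero_at_minimum:
  fixes f :: "'a::euclidean_space \<Rightarrow> real"
  assumes diff: "f differentiable (at x)" and min: "\<And>y. f x \<le> f y"
  shows "gradient f x = 0"
proof -
  have "(f has_derivative (\<lambda>h. h \<bullet> gradient f x)) (at x)"
    using gderiv_gradient[OF diff] by (simp add: gderiv_def)
  hence "(\<lambda>h. h \<bullet> gradient f x) = (\<lambda>h. 0)"
    by (rule differential_zero_maxmin[of x UNIV, rotated 2]) (use min in auto)
  thus ?thesis by (metis inner_eq_zero_iff)
qed

lemma smooth_with_mono:
  fixes f :: "'a::euclidean_space \<Rightarrow> real"
  assumes "smooth_with L f" "L \<le> L'"
  shows "smooth_with L' f"
  unfolding smooth_with_def
proof (intro allI)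
  fix x y :: 'a
  have "L / 2 * (norm (x - y))\<^sup>2 \<le> L' / 2 * (norm (x - y))\<^sup>2"
    by (rule mult_right_mono) (use assms(2) in auto)
  thus "f x \<le> f y + gradient f y \<bullet> (x - y) + L' / 2 * (norm (x - y))\<^sup>2"
    using assms(1) unfolding smooth_with_def by (smt (verit))
qed

lemma smooth_with_average:
  fixes f :: "nat \<Rightarrow> 'a::euclidean_space \<Rightarrow> real"
  assumes n: "n \<ge> 1"
    and diff: "\<And>i x. i \<in> {1..n} \<Longrightarrow> f i differentiable (at x)"
    and smooth: "\<And>i. i \<in> {1..n} \<Longrightarrow> smooth_with L (f i)"
  shows "smooth_with L (average n f)"
  unfolding smooth_with_def
proof (intro allI)
  fix x y :: 'a
  have "(\<Sum>i=1..n. f i x)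
      \<le> (\<Sum>i=1..n. f i y + gradient (f i) y \<bullet> (x - y) + L / 2 * (norm (x - y))\<^sup>2)"
    using smooth unfolding smooth_with_def by (intro sum_mono) blast
  also have "\<dots> = (\<Sum>i=1..n. f i y) + (\<Sum>i=1..n. gradient (f i) y) \<bullet> (x - y)
                + real n * (L / 2 * (norm (x - y))\<^sup>2)"
    by (simp add: sum.distrib inner_sum_left)
  finally have "average n f x \<le> ((\<Sum>i=1..n. f i y) + (\<Sum>i=1..n. gradient (f i) y) \<bullet> (x - y)
                + real n * (L / 2 * (norm (x - y))\<^sup>2)) / real n"
    by (simp add: average_def divide_right_mono)
  also have "\<dots> = average n f y + gradient (average n f) y \<bullet> (x - y)
                + L / 2 * (norm (x - y))\<^sup>2"
  proof -
    have "gradient (average n f) y = (\<Sum>i=1..n. gradient (f i) y) /\<^sub>R real n"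
      using diff by (intro gradient_eqI gderiv_average)
    thus ?thesis using n by (simp add: average_def add_divide_distrib) (simp add: divide_inverse mult.commute)
  qed
  finally show "average n f x \<le> average n f y + gradient (average n f) y \<bullet> (x - y)
                + L / 2 * (norm (x - y))\<^sup>2" .
qed

lemma convex_on_average:
  assumes "\<And>i. i \<in> {1..n} \<Longrightarrow> convex_on UNIV (f i)"
  shows "convex_on UNIV (average n f)"
proof -
  have "convex_on UNIV (\<lambda>x. inverse (real n) * (\<Sum>i\<in>I. f i x))" if "finite I" "I \<subseteq> {1..n}" for I
    using that
  proof (induction I)
    case empty
    show ?case by (simp add: convex_on_const)
  next
    case (insert i I)
    have "convex_on UNIV (\<lambda>x. inverse (real n) * f i x)"
      using assms insert by (intro convex_on_cmul) auto
    from convex_on_add[OF this insert.IH] insert show ?case by (simp add: ring_distribs)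
  qed
  from this[of "{1..n}"] show ?thesis
    by (simp add: average_def[abs_def] divide_inverse mult.commute)
qed

text \<open>The upper and the lower quadratic bound are compared at two points at distance 1, which exist
  because a Euclidean space has positive dimension.\<close>

lemma strongly_convex_le_smooth:
  fixes f :: "'a::euclidean_space \<Rightarrow> real"
  assumes "smooth_with L f" "strongly_convex_with \<mu> f"
  shows "\<mu> \<le> L"
proof -
  obtain b :: 'a where b: "norm b = 1" using vector_choose_size[of 1] by auto
  have "f b \<le> f 0 + gradient f 0 \<bullet> b + L / 2"
    using assms(1) b unfolding smooth_with_def by (metis diff_zero mult.right_neutral one_power2)
  moreover have "f 0 \<le> f b - gradient f 0 \<bullet> b - \<mu> / 2"
    using assms(2)[unfolded strongly_convex_with_def, rule_format, of 0 b] b by simp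
  ultimately show ?thesis by simp
qed

text \<open>The Bregman gap \<open>h z = f z - f y - gradient f y \<bullet> (z - y)\<close> is nonnegative by
  convexity, while smoothness shows that the gradient step from \<open>x\<close> to \<open>z\<close> with step size
  \<open>1 / L\<close> lowers it by at least
  \<open>1 / (2 * L)\<close> times the squared norm of its gradient \<open>d\<close> at \<open>x\<close>.  So \<open>h x\<close> is at least that large.\<close>

lemma gradient_diff_le_bregman:
  fixes f :: "'a::euclidean_space \<Rightarrow> real"
  assumes conv: "convex_on UNIV f" and diff: "\<And>x. f differentiable (at x)"
    and smooth: "smooth_with L f" and L: "L > 0"
  shows "(norm (gradient f x - gradient f y))\<^sup>2 \<le> 2 * L * (f x - f y - gradient f y \<bullet> (x - y))"
proof -
  define d where "d = gradient f x - gradient f y"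
  define z where "z = x - (1 / L) *\<^sub>R d"
  have "f y + gradient f y \<bullet> (z - y) \<le> f z"
    by (rule convex_on_above_gradient[OF conv diff])
  also have "f z \<le> f x + gradient f x \<bullet> (z - x) + L / 2 * (norm (z - x))\<^sup>2"
    using smooth unfolding smooth_with_def by blast
  also have "L / 2 * (norm (z - x))\<^sup>2 = (d \<bullet> d) / (2 * L)"
    using L by (simp add: z_def power_mult_distrib power2_norm_eq_inner power_divide)
      (simp add: power2_eq_square)
  finally have "f y + gradient f y \<bullet> (z - y) \<le> f x + gradient f x \<bullet> (z - x) + (d \<bullet> d) / (2 * L)" .
  moreover have "gradient f x \<bullet> (z - x) - gradient f y \<bullet> (z - y)
      = - (d \<bullet> d) / L - gradient f y \<bullet> (x - y)"
  proof -
    have "gradient f x \<bullet> (z - x) - gradient f y \<bullet> (z - y) = d \<bullet> (z - x) - gradient f y \<bullet> (x - y)"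
      by (simp add: d_def algebra_simps)
    thus ?thesis by (simp add: z_def)
  qed
  ultimately have "(d \<bullet> d) / L - (d \<bullet> d) / (2 * L) \<le> f x - f y - gradient f y \<bullet> (x - y)"
    by simp
  also have "(d \<bullet> d) / L - (d \<bullet> d) / (2 * L) = (d \<bullet> d) / (2 * L)"
    using L by (simp add: field_simps)
  finally show ?thesis using L by (simp add: d_def power2_norm_eq_inner field_simps)
qed

text \<open>Expanding the square leaves the second moment minus the squared norm of the mean.\<close>

lemma sum_norm_sub_mean_le:
  fixes v :: "'i \<Rightarrow> 'a::real_inner"
  assumes "finite A" "A \<noteq> {}"
  shows "(\<Sum>i\<in>A. (norm (v i - (\<Sum>j\<in>A. v j) /\<^sub>R real (card A)))\<^sup>2) \<le> (\<Sum>i\<in>A. (norm (v i))\<^sup>2)"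
proof -
  define c where "c = (\<Sum>j\<in>A. v j) /\<^sub>R real (card A)"
  have s: "(\<Sum>j\<in>A. v j) = real (card A) *\<^sub>R c" using assms by (simp add: c_def)
  have "(norm (v i - c))\<^sup>2 = (norm (v i))\<^sup>2 - 2 * (v i \<bullet> c) + c \<bullet> c" for i
    by (simp add: power2_norm_eq_inner inner_diff_left inner_diff_right inner_commute[of c "v i"])
  hence "(\<Sum>i\<in>A. (norm (v i - c))\<^sup>2)
      = (\<Sum>i\<in>A. (norm (v i))\<^sup>2) - 2 * ((\<Sum>i\<in>A. v i) \<bullet> c) + real (card A) * (c \<bullet> c)"
    by (simp add: sum.distrib sum_subtractf inner_sum_left sum_distrib_left)
  also have "\<dots> = (\<Sum>i\<in>A. (norm (v i))\<^sup>2) - real (card A) * (c \<bullet> c)" unfolding s by simp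
  finally show ?thesis by (simp add: c_def)
qed

section \<open>Expectations over finitely many independent draws\<close>

context prob_space
begin

lemma integrable_of_finite_draws:
  fixes h :: "('i \<Rightarrow> 'b) \<Rightarrow> real"
  assumes X: "\<And>k. k \<in> K \<Longrightarrow> X k \<in> measurable M (count_space A)"
    and fin: "finite K" "finite A"
  shows "integrable M (\<lambda>\<omega>. h (restrict (\<lambda>k. X k \<omega>) K))"
proof (rule integrable_const_bound)
  have R: "(\<lambda>\<omega>. restrict (\<lambda>k. X k \<omega>) K) \<in> measurable M (count_space (PiE K (\<lambda>_. A)))"
    using measurable_restrict[of K X M "\<lambda>_. count_space A"] X
      count_space_PiM_finite[of K "\<lambda>_. A"] fin countable_finite[of A] by simp
  show "(\<lambda>\<omega>. h (restrict (\<lambda>k. X k \<omega>) K)) \<in> borel_measurable M"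
    by (rule measurable_compose[OF R]) simp
  have "norm (h g) \<le> (\<Sum>g\<in>PiE K (\<lambda>_. A). norm (h g))" if "g \<in> PiE K (\<lambda>_. A)" for g
    using fin that by (intro member_le_sum finite_PiE) auto
  thus "AE \<omega> in M. norm (h (restrict (\<lambda>k. X k \<omega>) K)) \<le> (\<Sum>g\<in>PiE K (\<lambda>_. A). norm (h g))"
    using measurable_space[OF R] by (intro AE_I2) simp
qed

text \<open>Splitting by the value of the draw \<open>X k\<close>, which is independent of the draws indexed by \<open>K\<close>,
  replaces it by the uniform mean under the expectation.\<close>

lemma expectation_fresh_uniform_draw:
  fixes h :: "('i \<Rightarrow> 'b) \<Rightarrow> 'b \<Rightarrow> real"
  assumes ind: "indep_vars (\<lambda>_. count_space A) X I"
    and K: "K \<subseteq> I" "finite K" and k: "k \<in> I" "k \<notin> K" and A: "finite A"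
    and unif: "distr M (count_space A) (X k) = uniform_count_measure A"
  shows "expectation (\<lambda>\<omega>. h (restrict (\<lambda>k. X k \<omega>) K) (X k \<omega>))
       = expectation (\<lambda>\<omega>. (\<Sum>a\<in>A. h (restrict (\<lambda>k. X k \<omega>) K) a) / card A)"
proof -
  define R where "R = (\<lambda>\<omega>. restrict (\<lambda>k. X k \<omega>) K)"
  have X: "X i \<in> measurable M (count_space A)" if "i \<in> I" for i
    using ind that unfolding indep_vars_def by auto
  define ind_at :: "'b \<Rightarrow> 'b \<Rightarrow> real" where "ind_at = (\<lambda>a b. of_bool (b = a) :: real)"
  have int_h: "integrable M (\<lambda>\<omega>. h (R \<omega>) a)" for a
    unfolding R_def using X K A by (intro integrable_of_finite_draws[of K X A]) auto
  have int_ind: "integrable M (\<lambda>\<omega>. ind_at a (X k \<omega>))" for a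
    using X k A integrable_of_finite_draws[of "{k}" X A "\<lambda>g. ind_at a (g k)"] by auto
  have PiM_eq: "PiM C (\<lambda>_. count_space A) = count_space (PiE C (\<lambda>_. A))" if "finite C" for C :: "'i set"
    using that A by (intro count_space_PiM_finite) (auto intro: countable_finite)
  have mean: "expectation (\<lambda>\<omega>. h (R \<omega>) a * ind_at a (X k \<omega>)) = expectation (\<lambda>\<omega>. h (R \<omega>) a) / card A"
    and int_prod: "integrable M (\<lambda>\<omega>. h (R \<omega>) a * ind_at a (X k \<omega>))" if a: "a \<in> A" for a
  proof -
    have "indep_var (PiM K (\<lambda>_. count_space A)) R
            (PiM {k} (\<lambda>_. count_space A)) (\<lambda>\<omega>. restrict (\<lambda>i. X i \<omega>) {k})"
      unfolding R_def using K k by (intro indep_var_restrict[OF ind]) auto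
    from indep_var_compose[OF this, of "\<lambda>g. h g a" borel "\<lambda>g. ind_at a (g k)" borel]
    have iv: "indep_var borel (\<lambda>\<omega>. h (R \<omega>) a) borel (\<lambda>\<omega>. ind_at a (X k \<omega>))"
      using K by (simp add: PiM_eq o_def)
    have "expectation (\<lambda>\<omega>. ind_at a (X k \<omega>)) = integral\<^sup>L (distr M (count_space A) (X k)) (ind_at a)"
      using X k by (intro integral_distr[symmetric]) auto
    also have "\<dots> = 1 / card A"
      using a A by (simp add: unif integral_uniform_count_measure ind_at_def of_bool_def)
    finally show "expectation (\<lambda>\<omega>. h (R \<omega>) a * ind_at a (X k \<omega>)) = expectation (\<lambda>\<omega>. h (R \<omega>) a) / card A"
      using indep_var_lebesgue_integral[OF iv int_h int_ind] by simp
    show "integrable M (\<lambda>\<omega>. h (R \<omega>) a * ind_at a (X k \<omega>))"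
      by (rule indep_var_integrable[OF iv int_h int_ind])
  qed
  have "expectation (\<lambda>\<omega>. h (R \<omega>) (X k \<omega>)) = expectation (\<lambda>\<omega>. \<Sum>a\<in>A. h (R \<omega>) a * ind_at a (X k \<omega>))"
  proof (rule Bochner_Integration.integral_cong[OF refl])
    fix \<omega> assume "\<omega> \<in> space M"
    hence "X k \<omega> \<in> A" using measurable_space[OF X[OF k(1)]] by simp
    thus "h (R \<omega>) (X k \<omega>) = (\<Sum>a\<in>A. h (R \<omega>) a * ind_at a (X k \<omega>))"
      using A by (simp add: ind_at_def of_bool_def sum.delta if_distrib cong: if_cong)
  qed
  also have "\<dots> = (\<Sum>a\<in>A. expectation (\<lambda>\<omega>. h (R \<omega>) a)) / card A"
    using mean int_prod by (simp add: sum_divide_distrib)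
  also have "\<dots> = expectation (\<lambda>\<omega>. (\<Sum>a\<in>A. h (R \<omega>) a) / card A)"
    using int_h by simp
  finally show ?thesis by (simp add: R_def)
qed

end

section \<open>One step of the inner loop\<close>

locale strongly_convex_finite_sum =
  fixes f :: "nat \<Rightarrow> 'a::euclidean_space \<Rightarrow> real" and n :: nat and \<mu> L :: real and xstar :: 'a
  assumes n_pos: "n \<ge> 1"
    and mu_pos: "\<mu> > 0"
    and minimizer: "\<And>x. average n f xstar \<le> average n f x"
    and strongly_convex: "strongly_convex_with \<mu> (average n f)"
    and differentiable: "\<And>i x. i \<in> {1..n} \<Longrightarrow> f i differentiable (at x)"
    and convex: "\<And>i. i \<in> {1..n} \<Longrightarrow> convex_on UNIV (f i)"
    and smooth: "\<And>i. i \<in> {1..n} \<Longrightarrow> smooth_with L (f i)"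
begin

abbreviation F :: "'a \<Rightarrow> real" where "F \<equiv> average n f"

abbreviation gap :: "'a \<Rightarrow> real" where "gap x \<equiv> F x - F xstar"

lemma mu_le_L: "\<mu> \<le> L"
  using strongly_convex_le_smooth[OF smooth_with_average strongly_convex] n_pos differentiable smooth
  by blast

lemma L_pos: "L > 0"
  using mu_pos mu_le_L by simp

lemma sum_gradient: "(\<Sum>i=1..n. gradient (f i) x) = real n *\<^sub>R gradient F x"
  using n_pos gradient_eqI[OF gderiv_average, of n f x] differentiable by simp

lemma gradient_F_xstar: "gradient F xstar = 0"
proof (rule gradient_zero_at_minimum)
  show "F differentiable (at xstar)"
    using gderiv_average[of n f xstar] differentiable unfolding gderiv_def differentiable_def by blast
qed (rule minimizer)

text \<open>The linear terms of the Bregman gaps at \<open>xstar\<close> average to zero.\<close>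

lemma sum_gradient_diff_le_gap:
  "(\<Sum>i=1..n. (norm (gradient (f i) x - gradient (f i) xstar))\<^sup>2) \<le> real n * (2 * L * gap x)"
proof -
  have "(\<Sum>i=1..n. (norm (gradient (f i) x - gradient (f i) xstar))\<^sup>2)
      \<le> (\<Sum>i=1..n. 2 * L * (f i x - f i xstar - gradient (f i) xstar \<bullet> (x - xstar)))"
    using convex differentiable smooth L_pos by (intro sum_mono gradient_diff_le_bregman) auto
  also have "\<dots> = 2 * L * ((\<Sum>i=1..n. f i x) - (\<Sum>i=1..n. f i xstar)
      - (\<Sum>i=1..n. gradient (f i) xstar) \<bullet> (x - xstar))"
    by (simp add: sum_distrib_left[symmetric] sum_subtractf inner_sum_left)
  also have "\<dots> = real n * (2 * L * gap x)"
    using n_pos unfolding sum_gradient gradient_F_xstar by (simp add: average_def field_simps)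
  finally show ?thesis .
qed

definition svrg_direction :: "'a \<Rightarrow> 'a \<Rightarrow> nat \<Rightarrow> 'a" where
  "svrg_direction w y i = gradient (f i) y - gradient (f i) w + gradient F w"

lemma sum_svrg_direction: "(\<Sum>i=1..n. svrg_direction w y i) = real n *\<^sub>R gradient F y"
  unfolding svrg_direction_def sum.distrib sum_subtractf sum_gradient
  by (simp add: sum_constant_scaleR)

text \<open>Comparing both gradients with the one at \<open>xstar\<close> splits the direction into two parts; the part at
  the reference point \<open>w\<close> is centred, so its second moment is at most that of the uncentred
  difference.\<close>

lemma sum_norm_svrg_direction_le:
  "(\<Sum>i=1..n. (norm (svrg_direction w y i))\<^sup>2) \<le> real n * (4 * L * gap y + 4 * L * gap w)"
proof -
  define a where "a = (\<lambda>x i. gradient (f i) x - gradient (f i) xstar)"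
  have "(\<Sum>i=1..n. a w i) /\<^sub>R real n = gradient F w"
    using n_pos unfolding a_def sum_subtractf sum_gradient gradient_F_xstar by simp
  hence dir: "svrg_direction w y i = a y i - (a w i - (\<Sum>j\<in>{1..n}. a w j) /\<^sub>R real (card {1..n}))" for i
    by (simp add: svrg_direction_def a_def)
  have two: "(norm (u - v))\<^sup>2 \<le> 2 * (norm u)\<^sup>2 + 2 * (norm v)\<^sup>2" for u v :: 'a
  proof -
    have "2 * (norm u)\<^sup>2 + 2 * (norm v)\<^sup>2 - (norm (u - v))\<^sup>2 = (norm (u + v))\<^sup>2"
      by (simp add: power2_norm_eq_inner inner_diff_left inner_diff_right inner_add_left
          inner_add_right inner_commute)
    thus ?thesis by (smt (verit) zero_le_power2)
  qed
  have "(\<Sum>i=1..n. (norm (svrg_direction w y i))\<^sup>2)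
      \<le> (\<Sum>i=1..n. 2 * (norm (a y i))\<^sup>2
           + 2 * (norm (a w i - (\<Sum>j\<in>{1..n}. a w j) /\<^sub>R real (card {1..n})))\<^sup>2)"
    unfolding dir by (intro sum_mono two)
  also have "\<dots> \<le> 2 * (\<Sum>i=1..n. (norm (a y i))\<^sup>2) + 2 * (\<Sum>i=1..n. (norm (a w i))\<^sup>2)"
    using sum_norm_sub_mean_le[of "{1..n}" "a w"] n_pos
    by (simp add: sum.distrib sum_distrib_left[symmetric])
  also have "\<dots> \<le> 2 * (real n * (2 * L * gap y)) + 2 * (real n * (2 * L * gap w))"
    unfolding a_def by (intro add_mono mult_left_mono sum_gradient_diff_le_gap) auto
  also have "\<dots> = real n * (4 * L * gap y + 4 * L * gap w)" by (simp add: algebra_simps)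
  finally show ?thesis .
qed

text \<open>After expanding the square, the directions in the cross term sum to the gradient of \<open>F\<close>, where
  strong convexity produces both the factor \<open>1 - \<alpha> * \<mu>\<close> and a term in \<open>gap y\<close>; the second-moment bound
  takes back part of that term.\<close>

lemma mean_sq_dist_step_le:
  assumes "\<alpha> \<ge> 0"
  shows "(\<Sum>i=1..n. (norm (y - \<alpha> *\<^sub>R svrg_direction w y i - xstar))\<^sup>2) / real n
    \<le> (1 - \<alpha> * \<mu>) * (norm (y - xstar))\<^sup>2 - 2 * \<alpha> * (1 - 2 * \<alpha> * L) * gap y + 4 * \<alpha>\<^sup>2 * L * gap w"
proof -
  have "(norm (y - \<alpha> *\<^sub>R g - xstar))\<^sup>2
      = (norm (y - xstar))\<^sup>2 - 2 * \<alpha> * (g \<bullet> (y - xstar)) + \<alpha>\<^sup>2 * (norm g)\<^sup>2" for g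
  proof -
    have "y - \<alpha> *\<^sub>R g - xstar = (y - xstar) - \<alpha> *\<^sub>R g" by simp
    thus ?thesis
      by (simp only: power2_norm_eq_inner inner_diff_left[of "y - xstar"] inner_diff_right[of _ "y - xstar"])
        (simp add: inner_commute[of "y - xstar" g] power2_eq_square)
  qed
  hence "(\<Sum>i=1..n. (norm (y - \<alpha> *\<^sub>R svrg_direction w y i - xstar))\<^sup>2)
      = real n * (norm (y - xstar))\<^sup>2 - 2 * \<alpha> * ((\<Sum>i=1..n. svrg_direction w y i) \<bullet> (y - xstar))
        + \<alpha>\<^sup>2 * (\<Sum>i=1..n. (norm (svrg_direction w y i))\<^sup>2)"
    by (simp add: sum.distrib sum_subtractf sum_distrib_left inner_sum_left)
  also have "\<dots> \<le> real n * (norm (y - xstar))\<^sup>2 - 2 * \<alpha> * (real n * (gradient F y \<bullet> (y - xstar)))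
        + \<alpha>\<^sup>2 * (real n * (4 * L * gap y + 4 * L * gap w))"
    unfolding sum_svrg_direction
    using mult_left_mono[OF sum_norm_svrg_direction_le[of w y], of "\<alpha>\<^sup>2"] by simp
  also have "\<dots> = real n * ((norm (y - xstar))\<^sup>2 - 2 * \<alpha> * (gradient F y \<bullet> (y - xstar))
        + \<alpha>\<^sup>2 * (4 * L * gap y + 4 * L * gap w))" by (simp add: algebra_simps)
  finally have "(\<Sum>i=1..n. (norm (y - \<alpha> *\<^sub>R svrg_direction w y i - xstar))\<^sup>2) / real n
      \<le> (norm (y - xstar))\<^sup>2 - 2 * \<alpha> * (gradient F y \<bullet> (y - xstar))
        + \<alpha>\<^sup>2 * (4 * L * gap y + 4 * L * gap w)"
    using n_pos by (simp add: pos_divide_le_eq mult.commute)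
  moreover have "2 * \<alpha> * (gap y + \<mu> / 2 * (norm (y - xstar))\<^sup>2) \<le> 2 * \<alpha> * (gradient F y \<bullet> (y - xstar))"
    using strongly_convex[unfolded strongly_convex_with_def, rule_format, of y xstar] assms
    by (intro mult_left_mono) auto
  ultimately show ?thesis by (simp add: algebra_simps power2_eq_square)
qed

end

lemma geometric_unroll:
  fixes a d :: "nat \<Rightarrow> real"
  assumes q: "q \<ge> 0"
    and step: "\<And>t. t < k \<Longrightarrow> a (Suc t) \<le> q * a t - c * d t + e"
  shows "a k \<le> q ^ k * a 0 - c * (\<Sum>t<k. q ^ (k - 1 - t) * d t) + e * (\<Sum>t<k. q ^ (k - 1 - t))"
  using step
proof (induction k)
  case (Suc k)
  have shift: "(\<Sum>t<Suc k. q ^ (Suc k - 1 - t) * b t) = q * (\<Sum>t<k. q ^ (k - 1 - t) * b t) + b k"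
    for b :: "nat \<Rightarrow> real"
  proof -
    have "q ^ (k - t) = q * q ^ (k - 1 - t)" if "t < k" for t
      using that by (metis Suc_diff_Suc diff_Suc_1 minus_nat.diff_0 diff_commute diff_Suc_eq_diff_pred power_Suc)
    thus ?thesis by (simp add: sum_distrib_left mult.assoc)
  qed
  have "a (Suc k) \<le> q * a k - c * d k + e" using Suc.prems by simp
  also have "q * a k \<le> q * (q ^ k * a 0 - c * (\<Sum>t<k. q ^ (k - 1 - t) * d t)
      + e * (\<Sum>t<k. q ^ (k - 1 - t)))"
    using Suc q by (intro mult_left_mono) auto
  finally show ?case
    unfolding shift[of d] using shift[of "\<lambda>_. 1"] by (simp add: algebra_simps)
qed simp

lemma inner_loop_cong:
  "(\<And>i. i < t \<Longrightarrow> j i = j' i) \<Longrightarrow> inner_loop n f \<alpha> j w x t = inner_loop n f \<alpha> j' w x t"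
  by (induction t) (simp_all add: Let_def)

lemma free_svrg_cong:
  assumes "\<And>s' t. s' \<in> {1..s} \<Longrightarrow> t < m \<Longrightarrow> j s' t = j' s' t"
  shows "free_svrg n f \<alpha> \<mu> m x0 j s = free_svrg n f \<alpha> \<mu> m x0 j' s"
  using assms
proof (induction s)
  case (Suc s)
  have eq: "inner_loop n f \<alpha> (j (Suc s)) w x t = inner_loop n f \<alpha> (j' (Suc s)) w x t" if "t \<le> m" for w x t
    using that Suc.prems by (intro inner_loop_cong) auto
  have IH: "free_svrg n f \<alpha> \<mu> m x0 j s = free_svrg n f \<alpha> \<mu> m x0 j' s"
    using Suc by simp
  show ?case by (auto simp: IH eq Let_def split: prod.split intro!: sum.cong)
qed simp

section \<open>Contraction of the expected Lyapunov function\<close>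

locale free_svrg_run = strongly_convex_finite_sum f n \<mu> L xstar + prob_space M
  for f :: "nat \<Rightarrow> 'a::euclidean_space \<Rightarrow> real" and n \<mu> L xstar and M :: "'w measure" +
  fixes m :: nat and \<alpha> :: real and x0 :: 'a and J :: "nat \<Rightarrow> nat \<Rightarrow> 'w \<Rightarrow> nat"
  assumes m_pos: "m \<ge> 1"
    and alpha_pos: "\<alpha> > 0"
    and alpha_le: "6 * \<alpha> * L \<le> 1"
    and draws: "uniform_index_draws M n m J"
begin

text \<open>As in the recursion that defines the method, \<open>inner_iterate s\<close> runs through the inner loop that leads from
  outer iteration \<open>s\<close> to \<open>Suc s\<close>; its draws carry the index \<open>Suc s\<close>.\<close>

definition outer_iterate :: "nat \<Rightarrow> 'w \<Rightarrow> 'a" where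
  "outer_iterate s \<omega> = fst (free_svrg n f \<alpha> \<mu> m x0 (\<lambda>s t. J s t \<omega>) s)"

definition reference :: "nat \<Rightarrow> 'w \<Rightarrow> 'a" where
  "reference s \<omega> = snd (free_svrg n f \<alpha> \<mu> m x0 (\<lambda>s t. J s t \<omega>) s)"

definition inner_iterate :: "nat \<Rightarrow> nat \<Rightarrow> 'w \<Rightarrow> 'a" where
  "inner_iterate s t \<omega> = inner_loop n f \<alpha> (\<lambda>t. J (Suc s) t \<omega>) (reference s \<omega>) (outer_iterate s \<omega>) t"

lemma inner_iterate_0: "inner_iterate s 0 \<omega> = outer_iterate s \<omega>"
  by (simp add: inner_iterate_def)

lemma inner_iterate_Suc:
  "inner_iterate s (Suc t) \<omega> = inner_iterate s t \<omega> - \<alpha> *\<^sub>R svrg_direction (reference s \<omega>) (inner_iterate s t \<omega>) (J (Suc s) t \<omega>)"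
  by (simp add: inner_iterate_def Let_def svrg_direction_def)

lemma outer_iterate_Suc: "outer_iterate (Suc s) \<omega> = inner_iterate s m \<omega>"
  by (simp add: outer_iterate_def inner_iterate_def reference_def Let_def split: prod.split)

lemma reference_Suc: "reference (Suc s) \<omega> = (\<Sum>t<m. p_weight \<alpha> \<mu> m t *\<^sub>R inner_iterate s t \<omega>)"
  by (simp add: outer_iterate_def inner_iterate_def reference_def Let_def split: prod.split)

text \<open>The indices of the draws made before \<open>inner_iterate s t\<close> is computed; the next draw has index \<open>(Suc s, t)\<close>.\<close>

definition past :: "nat \<Rightarrow> nat \<Rightarrow> (nat \<times> nat) set" where
  "past s t = {1..s} \<times> {..<m} \<union> {Suc s} \<times> {..<t}"

definition history :: "(nat \<times> nat) set \<Rightarrow> 'w \<Rightarrow> nat \<times> nat \<Rightarrow> nat" where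
  "history K \<omega> = restrict (\<lambda>k. (case k of (s, t) \<Rightarrow> J s t) \<omega>) K"

text \<open>This factorisation through finitely many draws gives integrability of every function of the state, and its
  independence of the next draw.\<close>

lemma state_determined_by_past:
  assumes "t \<le> m"
  obtains state where "\<And>\<omega>. (inner_iterate s t \<omega>, reference s \<omega>) = state (history (past s t) \<omega>)"
proof
  fix \<omega>
  define state where "state = (\<lambda>h :: nat \<times> nat \<Rightarrow> nat.
    let (x, w) = free_svrg n f \<alpha> \<mu> m x0 (curry h) s
    in (inner_loop n f \<alpha> (curry h (Suc s)) w x t, w))"
  have "free_svrg n f \<alpha> \<mu> m x0 (\<lambda>s t. J s t \<omega>) s
      = free_svrg n f \<alpha> \<mu> m x0 (curry (history (past s t) \<omega>)) s"
    by (rule free_svrg_cong) (auto simp: history_def past_def)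
  moreover have "inner_loop n f \<alpha> (J' (Suc s)) w x t
      = inner_loop n f \<alpha> (curry (history (past s t) \<omega>) (Suc s)) w x t"
    if "J' = (\<lambda>s t. J s t \<omega>)" for w x J'
    by (rule inner_loop_cong) (auto simp: history_def past_def that)
  ultimately show "(inner_iterate s t \<omega>, reference s \<omega>) = state (history (past s t) \<omega>)"
    by (simp add: state_def inner_iterate_def reference_def outer_iterate_def split: prod.split)
qed

lemma finite_past: "finite (past s t)"
  by (simp add: past_def)

lemma past_subset: "t \<le> m \<Longrightarrow> past s t \<subseteq> {1..} \<times> {..<m}"
  by (auto simp: past_def)

lemma indep_draws: "indep_vars (\<lambda>_. count_space {1..n}) (\<lambda>(s, t). J s t) ({1..} \<times> {..<m})"
  using draws by (simp add: uniform_index_draws_def)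

lemma integrable_state:
  fixes h :: "'a \<Rightarrow> 'a \<Rightarrow> real"
  assumes t: "t \<le> m"
  shows "integrable M (\<lambda>\<omega>. h (inner_iterate s t \<omega>) (reference s \<omega>))"
proof -
  obtain state where st: "\<And>\<omega>. (inner_iterate s t \<omega>, reference s \<omega>) = state (history (past s t) \<omega>)"
    using state_determined_by_past[OF t] by blast
  have X: "(case k of (s, t) \<Rightarrow> J s t) \<in> measurable M (count_space {1..n})" if "k \<in> past s t" for k
    using indep_draws past_subset[OF t, of s] that unfolding indep_vars_def by blast
  have "integrable M (\<lambda>\<omega>. (\<lambda>g. case_prod h (state g)) (history (past s t) \<omega>))"
    unfolding history_def by (rule integrable_of_finite_draws[OF X finite_past]) auto
  thus ?thesis by (simp add: st[symmetric])
qed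

lemmas integrable_outer_state = integrable_state[of 0, unfolded inner_iterate_0, OF le0]

lemma expectation_sq_dist_step_le:
  assumes t: "t < m"
  shows "expectation (\<lambda>\<omega>. (norm (inner_iterate s (Suc t) \<omega> - xstar))\<^sup>2)
    \<le> (1 - \<alpha> * \<mu>) * expectation (\<lambda>\<omega>. (norm (inner_iterate s t \<omega> - xstar))\<^sup>2)
      - 2 * \<alpha> * (1 - 2 * \<alpha> * L) * expectation (\<lambda>\<omega>. gap (inner_iterate s t \<omega>))
      + 4 * \<alpha>\<^sup>2 * L * expectation (\<lambda>\<omega>. gap (reference s \<omega>))"
proof -
  have t': "t \<le> m" using t by simp
  obtain state where st: "\<And>\<omega>. (inner_iterate s t \<omega>, reference s \<omega>) = state (history (past s t) \<omega>)"
    using state_determined_by_past[OF t'] by blast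
  define G where "G = (\<lambda>(y, w) i. (norm (y - \<alpha> *\<^sub>R svrg_direction w y i - xstar))\<^sup>2)"
  have "expectation (\<lambda>\<omega>. (norm (inner_iterate s (Suc t) \<omega> - xstar))\<^sup>2)
      = expectation (\<lambda>\<omega>. G (state (history (past s t) \<omega>)) ((case (Suc s, t) of (s, t) \<Rightarrow> J s t) \<omega>))"
    by (simp add: inner_iterate_Suc G_def st[symmetric])
  also have "\<dots> = expectation (\<lambda>\<omega>. (\<Sum>i\<in>{1..n}. G (state (history (past s t) \<omega>)) i) / card {1..n})"
    unfolding history_def
  proof (rule expectation_fresh_uniform_draw[OF indep_draws past_subset[OF t'] finite_past])
    show "distr M (count_space {1..n}) (case (Suc s, t) of (s, t) \<Rightarrow> J s t)
        = uniform_count_measure {1..n}"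
      using draws t by (simp add: uniform_index_draws_def)
  qed (use t in \<open>auto simp: past_def\<close>)
  also have "\<dots> = expectation (\<lambda>\<omega>. (\<Sum>i=1..n.
      (norm (inner_iterate s t \<omega> - \<alpha> *\<^sub>R svrg_direction (reference s \<omega>) (inner_iterate s t \<omega>) i - xstar))\<^sup>2) / n)"
    by (simp add: G_def st[symmetric])
  also have "\<dots> \<le> expectation (\<lambda>\<omega>. (1 - \<alpha> * \<mu>) * (norm (inner_iterate s t \<omega> - xstar))\<^sup>2
      - 2 * \<alpha> * (1 - 2 * \<alpha> * L) * gap (inner_iterate s t \<omega>) + 4 * \<alpha>\<^sup>2 * L * gap (reference s \<omega>))"
    using alpha_pos
    by (intro integral_mono mean_sq_dist_step_le
        integrable_state[OF t', of "\<lambda>y w. (\<Sum>i=1..n. (norm (y - \<alpha> *\<^sub>R svrg_direction w y i - xstar))\<^sup>2) / n"]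
        integrable_state[OF t', of "\<lambda>y w. (1 - \<alpha> * \<mu>) * (norm (y - xstar))\<^sup>2
          - 2 * \<alpha> * (1 - 2 * \<alpha> * L) * gap y + 4 * \<alpha>\<^sup>2 * L * gap w"]) auto
  also have "\<dots> = (1 - \<alpha> * \<mu>) * expectation (\<lambda>\<omega>. (norm (inner_iterate s t \<omega> - xstar))\<^sup>2)
      - 2 * \<alpha> * (1 - 2 * \<alpha> * L) * expectation (\<lambda>\<omega>. gap (inner_iterate s t \<omega>))
      + 4 * \<alpha>\<^sup>2 * L * expectation (\<lambda>\<omega>. gap (reference s \<omega>))"
  proof -
    have 1: "integrable M (\<lambda>\<omega>. (norm (inner_iterate s t \<omega> - xstar))\<^sup>2)"
      by (rule integrable_state[OF t', of "\<lambda>y w. (norm (y - xstar))\<^sup>2"])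
    have 2: "integrable M (\<lambda>\<omega>. gap (inner_iterate s t \<omega>))"
      by (rule integrable_state[OF t', of "\<lambda>y w. gap y"])
    have 3: "integrable M (\<lambda>\<omega>. gap (reference s \<omega>))"
      by (rule integrable_state[OF t', of "\<lambda>y w. gap w"])
    show ?thesis
      by (simp only: Bochner_Integration.integral_add Bochner_Integration.integral_diff
          integral_mult_right_zero integrable_mult_right Bochner_Integration.integrable_diff 1 2 3)
  qed
  finally show ?thesis .
qed

lemma alpha_mu_le: "\<alpha> * \<mu> \<le> 1 / 6"
proof -
  have "\<alpha> * \<mu> \<le> \<alpha> * L" using mu_le_L alpha_pos by simp
  thus ?thesis using alpha_le by simp
qed

lemma S_weight_pos: "S_weight \<alpha> \<mu> m > 0"
  unfolding S_weight_def using alpha_mu_le m_pos by (intro sum_pos) (auto simp: lessThan_empty_iff)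

text \<open>Jensen's inequality for the averaged reference point, cleared of the normalisation of its weights.\<close>

lemma gap_reference_Suc_le:
  "S_weight \<alpha> \<mu> m * gap (reference (Suc s) \<omega>)
    \<le> (\<Sum>t<m. (1 - \<alpha> * \<mu>) ^ (m - 1 - t) * gap (inner_iterate s t \<omega>))"
proof -
  have p: "(\<Sum>t<m. p_weight \<alpha> \<mu> m t) = 1"
    using S_weight_pos by (simp add: p_weight_def sum_divide_distrib[symmetric] S_weight_def)
  have "F (reference (Suc s) \<omega>) \<le> (\<Sum>t<m. p_weight \<alpha> \<mu> m t * F (inner_iterate s t \<omega>))"
    unfolding reference_Suc using p m_pos alpha_mu_le S_weight_pos
    by (intro convex_on_sum[OF _ _ convex_on_average[OF convex]])
      (auto simp: p_weight_def lessThan_empty_iff)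
  hence "gap (reference (Suc s) \<omega>)
      \<le> (\<Sum>t<m. p_weight \<alpha> \<mu> m t * F (inner_iterate s t \<omega>)) - (\<Sum>t<m. p_weight \<alpha> \<mu> m t) * F xstar"
    by (simp add: p)
  also have "\<dots> = (\<Sum>t<m. p_weight \<alpha> \<mu> m t * gap (inner_iterate s t \<omega>))"
    by (simp add: sum_distrib_right sum_subtractf right_diff_distrib)
  also have "\<dots> = (\<Sum>t<m. (1 - \<alpha> * \<mu>) ^ (m - 1 - t) * gap (inner_iterate s t \<omega>)) / S_weight \<alpha> \<mu> m"
    by (simp add: p_weight_def sum_divide_distrib)
  finally show ?thesis using S_weight_pos by (simp add: field_simps)
qed

text \<open>The coefficient of the gap is twice what one inner loop charges to its reference point, namely
  \<open>4 * \<alpha>\<^sup>2 * L * S_weight \<alpha> \<mu> m\<close>; this is the source of the factor \<open>1 / 2\<close> in the rate.\<close>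

definition lyapunov :: "'a \<Rightarrow> 'a \<Rightarrow> real" where
  "lyapunov x w = (norm (x - xstar))\<^sup>2 + 8 * \<alpha>\<^sup>2 * L * S_weight \<alpha> \<mu> m * gap w"

lemma sq_dist_le_lyapunov: "(norm (x - xstar))\<^sup>2 \<le> lyapunov x w"
  unfolding lyapunov_def using minimizer[of w] L_pos S_weight_pos by simp

definition rate :: real where
  "rate = max ((1 - \<alpha> * \<mu>) ^ m) (1 / 2)"

text \<open>The gain \<open>2 * \<alpha> * (1 - 2 * \<alpha> * L)\<close> on the averaged gap pays for the coefficient \<open>8 * \<alpha>\<^sup>2 * L\<close> of the new
  reference point precisely when \<open>6 * \<alpha> * L \<le> 1\<close>; this is where the step size restriction comes from.\<close>

lemma expectation_lyapunov_contracts: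
  "expectation (\<lambda>\<omega>. lyapunov (outer_iterate (Suc s) \<omega>) (reference (Suc s) \<omega>))
    \<le> rate * expectation (\<lambda>\<omega>. lyapunov (outer_iterate s \<omega>) (reference s \<omega>))"
proof -
  define q where "q = 1 - \<alpha> * \<mu>"
  define S where "S = S_weight \<alpha> \<mu> m"
  define a where "a = (\<lambda>t. expectation (\<lambda>\<omega>. (norm (inner_iterate s t \<omega> - xstar))\<^sup>2))"
  define d where "d = (\<lambda>t. expectation (\<lambda>\<omega>. gap (inner_iterate s t \<omega>)))"
  define g where "g = (\<lambda>s. expectation (\<lambda>\<omega>. gap (reference s \<omega>)))"
  have S: "S > 0" "S = (\<Sum>t<m. q ^ (m - 1 - t))"
    using S_weight_pos by (simp_all add: S_def S_weight_def q_def)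
  have int_g: "integrable M (\<lambda>\<omega>. gap (reference s \<omega>))" for s
    by (rule integrable_outer_state[of "\<lambda>x w. gap w"])
  have int_d: "integrable M (\<lambda>\<omega>. gap (inner_iterate s t \<omega>))" if "t < m" for t
    using that by (intro integrable_state[of t "\<lambda>x w. gap x"]) auto
  have lyap: "expectation (\<lambda>\<omega>. lyapunov (outer_iterate s \<omega>) (reference s \<omega>))
      = expectation (\<lambda>\<omega>. (norm (outer_iterate s \<omega> - xstar))\<^sup>2) + 8 * \<alpha>\<^sup>2 * L * S * g s" for s
    unfolding lyapunov_def S_def[symmetric] g_def
    using int_g[of s] integrable_outer_state[of "\<lambda>x w. (norm (x - xstar))\<^sup>2" s]
    by (simp only: Bochner_Integration.integral_add integral_mult_right_zero integrable_mult_right)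
  have g_nonneg: "g s \<ge> 0" for s
    unfolding g_def using minimizer by (intro Bochner_Integration.integral_nonneg) auto
  have a_nonneg: "a t \<ge> 0" for t unfolding a_def by simp
  have unrolled: "a m \<le> q ^ m * a 0 - 2 * \<alpha> * (1 - 2 * \<alpha> * L) * (\<Sum>t<m. q ^ (m - 1 - t) * d t)
      + 4 * \<alpha>\<^sup>2 * L * g s * S"
    unfolding S(2)
    by (rule geometric_unroll) (use alpha_mu_le expectation_sq_dist_step_le in \<open>auto simp: q_def a_def d_def g_def\<close>)
  have "S * g (Suc s) = expectation (\<lambda>\<omega>. S * gap (reference (Suc s) \<omega>))"
    by (simp add: g_def)
  also have "\<dots> \<le> expectation (\<lambda>\<omega>. \<Sum>t<m. q ^ (m - 1 - t) * gap (inner_iterate s t \<omega>))"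
    using int_d int_g gap_reference_Suc_le
    by (intro integral_mono Bochner_Integration.integrable_sum integrable_mult_right)
      (auto simp: S_def q_def)
  also have "\<dots> = (\<Sum>t<m. q ^ (m - 1 - t) * d t)"
    unfolding d_def using int_d by (subst Bochner_Integration.integral_sum) auto
  finally have jensen: "S * g (Suc s) \<le> (\<Sum>t<m. q ^ (m - 1 - t) * d t)" .
  have "4 * \<alpha> * L \<le> 1 - 2 * \<alpha> * L" using alpha_le by linarith
  hence "2 * \<alpha> * (4 * \<alpha> * L) \<le> 2 * \<alpha> * (1 - 2 * \<alpha> * L)"
    using alpha_pos by (intro mult_left_mono) auto
  moreover have "(2 * \<alpha> * (4 * \<alpha> * L)) * (S * g (Suc s)) \<le> (2 * \<alpha> * (1 - 2 * \<alpha> * L)) * (S * g (Suc s))"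
    using calculation S g_nonneg by (intro mult_right_mono) auto
  moreover have "(2 * \<alpha> * (1 - 2 * \<alpha> * L)) * (S * g (Suc s))
      \<le> (2 * \<alpha> * (1 - 2 * \<alpha> * L)) * (\<Sum>t<m. q ^ (m - 1 - t) * d t)"
    using \<open>4 * \<alpha> * L \<le> 1 - 2 * \<alpha> * L\<close> alpha_pos L_pos
    by (intro mult_left_mono[OF jensen] mult_nonneg_nonneg) (auto intro: order_trans[rotated])
  ultimately have "a m + 8 * \<alpha>\<^sup>2 * L * S * g (Suc s) \<le> q ^ m * a 0 + 1 / 2 * (8 * \<alpha>\<^sup>2 * L * S * g s)"
    using unrolled by (simp add: algebra_simps power2_eq_square)
  also have "\<dots> \<le> rate * a 0 + rate * (8 * \<alpha>\<^sup>2 * L * S * g s)"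
    using a_nonneg g_nonneg S L_pos by (intro add_mono mult_right_mono) (auto simp: rate_def q_def)
  finally show ?thesis
    unfolding lyap by (simp add: outer_iterate_Suc a_def inner_iterate_0 algebra_simps)
qed

lemma rate_nonneg: "rate \<ge> 0"
  by (simp add: rate_def le_max_iff_disj)

lemma expectation_sq_dist_le:
  "expectation (\<lambda>\<omega>. (norm (outer_iterate s \<omega> - xstar))\<^sup>2) \<le> rate ^ s * lyapunov x0 x0"
proof -
  have "expectation (\<lambda>\<omega>. lyapunov (outer_iterate s \<omega>) (reference s \<omega>)) \<le> rate ^ s * lyapunov x0 x0"
  proof (induction s)
    case 0
    show ?case by (simp add: outer_iterate_def reference_def prob_space)
  next
    case (Suc s)
    show ?case
      using expectation_lyapunov_contracts[of s] mult_left_mono[OF Suc rate_nonneg] by simp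
  qed
  moreover have "expectation (\<lambda>\<omega>. (norm (outer_iterate s \<omega> - xstar))\<^sup>2)
      \<le> expectation (\<lambda>\<omega>. lyapunov (outer_iterate s \<omega>) (reference s \<omega>))"
    by (intro integral_mono sq_dist_le_lyapunov integrable_outer_state[of "\<lambda>x w. (norm (x - xstar))\<^sup>2"]
        integrable_outer_state[of lyapunov])
  ultimately show ?thesis by simp
qed

text \<open>Both entries of the maximum decay exponentially, by \<open>1 - x \<le> exp (- x)\<close>: at \<open>x = \<alpha> * \<mu>\<close> for the first
  and at \<open>x = 1 / 2\<close> for the second.\<close>

lemma rate_power_le:
  assumes eps: "0 < \<epsilon>" "\<epsilon> \<le> 1"
    and s: "real s \<ge> max (1 / (\<alpha> * \<mu> * real m)) 2 * ln (1 / \<epsilon>)"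
  shows "rate ^ s \<le> \<epsilon>"
proof -
  define l where "l = ln (1 / \<epsilon>)"
  have l: "l \<ge> 0" using eps by (simp add: l_def)
  have decay: "r ^ s \<le> \<epsilon>" if r: "0 \<le> r" "r \<le> exp (- b)" and b: "b > 0" and sb: "real s \<ge> 1 / b * l" for r b
  proof -
    have "r ^ s \<le> exp (- b) ^ s" using r by (intro power_mono)
    also have "\<dots> = exp (- (real s * b))" by (simp add: exp_of_nat_mult[symmetric])
    also have "\<dots> \<le> exp (- l)" using sb b by (simp add: field_simps)
    also have "\<dots> = \<epsilon>" using eps by (simp add: l_def ln_div)
    finally show ?thesis .
  qed
  have sl: "real s \<ge> c * l" if "c \<le> max (1 / (\<alpha> * \<mu> * real m)) 2" for c
    using mult_right_mono[OF that l] s by (simp add: l_def)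
  have "((1 - \<alpha> * \<mu>) ^ m) ^ s \<le> \<epsilon>"
  proof (rule decay)
    have "(1 - \<alpha> * \<mu>) ^ m \<le> exp (- (\<alpha> * \<mu>)) ^ m"
      using alpha_mu_le exp_ge_add_one_self[of "- (\<alpha> * \<mu>)"] by (intro power_mono) auto
    thus "(1 - \<alpha> * \<mu>) ^ m \<le> exp (- (\<alpha> * \<mu> * real m))"
      by (simp add: exp_of_nat_mult[symmetric] mult.commute)
    show "0 \<le> (1 - \<alpha> * \<mu>) ^ m" using alpha_mu_le by simp
    show "0 < \<alpha> * \<mu> * real m" using alpha_pos mu_pos m_pos by simp
  qed (rule sl, simp)
  moreover have "(1 / 2) ^ s \<le> \<epsilon>"
  proof (rule decay)
    show "1 / 2 \<le> exp (- (1 / 2 :: real))" using exp_ge_add_one_self[of "- (1 / 2)"] by simp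
  qed (auto intro: sl[of 2, simplified])
  ultimately show ?thesis by (simp add: rate_def max_def)
qed

end

section \<open>Complexity\<close>

text \<open>If \<open>3 * k \<le> m\<close>, then \<open>m \<le> n\<close> because \<open>k < m\<close>, and the left side is \<open>2 * n + 4 * m\<close>.
  Otherwise the only delicate term is \<open>n * k / m\<close>, and \<open>n * k = min n k * max n k\<close>.\<close>

lemma complexity_factor_le:
  fixes n m k :: real
  assumes "n > 0" "k > 0" "m > 0" "min n k \<le> m" "m \<le> max n k"
  shows "2 * (n / m + 2) * max (3 * k) m \<le> 18 * (n + k)"
proof (cases "3 * k \<le> m")
  case True
  hence "m \<le> n" using assms by (auto simp: max_def split: if_splits)
  moreover have "2 * (n / m + 2) * max (3 * k) m = 2 * n + 4 * m"
    using True assms by (simp add: field_simps max_def)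
  ultimately show ?thesis using assms by simp
next
  case False
  have "n * k = min n k * max n k" by (simp add: min_def max_def)
  also have "\<dots> \<le> m * max n k" using assms by (intro mult_right_mono) auto
  also have "\<dots> \<le> m * (n + k)" using assms by (intro mult_left_mono) auto
  finally have "n * k / m \<le> n + k" using assms by (simp add: field_simps)
  moreover have "2 * (n / m + 2) * max (3 * k) m = 6 * (n * k / m) + 12 * k"
    using False by (simp add: max_def algebra_simps)
  ultimately show ?thesis using assms by simp
qed

theorem corollary4p3:
  fixes f :: "nat \<Rightarrow> 'a::euclidean_space \<Rightarrow> real"
    and n m :: nat
    and L \<mu> Lmax \<alpha> \<epsilon> \<phi>0 :: real
    and Ls :: "nat \<Rightarrow> real"
    and xstar x0 :: 'a
    and M :: "'w measure"
    and J :: "nat \<Rightarrow> nat \<Rightarrow> 'w \<Rightarrow> nat"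
  assumes n: "n \<ge> 2"
    and minimizer: "\<And>x. average n f xstar \<le> average n f x"
    and smooth: "smooth_with L (average n f)"
    and \<mu>: "\<mu> > 0"
    and strongly_convex: "strongly_convex_with \<mu> (average n f)"
    and fi_differentiable: "\<And>i x. i \<in> {1..n} \<Longrightarrow> f i differentiable (at x)"
    and fi_convex: "\<And>i. i \<in> {1..n} \<Longrightarrow> convex_on UNIV (f i)"
    and fi_smooth: "\<And>i. i \<in> {1..n} \<Longrightarrow> smooth_with (Ls i) (f i)"
    and Lmax: "Lmax = Max (Ls ` {1..n})"
    and M: "prob_space M"
    and draws: "uniform_index_draws M n m J"
    and m: "m \<ge> 1"
    and \<alpha>: "\<alpha> = 1 / (6 * Lmax)"
    and \<epsilon>: "0 < \<epsilon>" "\<epsilon> \<le> 1"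
    and m_range: "real m \<in> {min (real n) (Lmax / \<mu>) .. max (real n) (Lmax / \<mu>)}"
    and \<phi>0: "\<phi>0 = (norm (x0 - xstar))\<^sup>2
                 + 8 * \<alpha>\<^sup>2 * Lmax * S_weight \<alpha> \<mu> m * (average n f x0 - average n f xstar)"
  defines "sq_dist \<equiv> (\<lambda>s \<omega>. (norm (fst (free_svrg n f \<alpha> \<mu> m x0 (\<lambda>s t. J s t \<omega>) s) - xstar))\<^sup>2)"
  shows "(\<forall>s. integrable M (sq_dist s))
    \<and> (\<forall>s. real (gradient_evals n m s) \<ge> total_complexity n Lmax \<mu> m \<epsilon>
         \<longrightarrow> (\<integral>\<omega>. sq_dist s \<omega> \<partial>M) \<le> \<epsilon> * \<phi>0)
    \<and> total_complexity n Lmax \<mu> m \<epsilon> \<le> 18 * (real n + Lmax / \<mu>) * ln (1 / \<epsilon>)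
    \<and> (\<forall>s. real (gradient_evals n m s) \<ge> 18 * (real n + Lmax / \<mu>) * ln (1 / \<epsilon>)
         \<longrightarrow> (\<integral>\<omega>. sq_dist s \<omega> \<partial>M) \<le> \<epsilon> * \<phi>0)"
proof -
  have "smooth_with Lmax (f i)" if "i \<in> {1..n}" for i
    using that by (intro smooth_with_mono[OF fi_smooth[OF that]]) (auto simp: Lmax)
  then interpret strongly_convex_finite_sum f n \<mu> Lmax xstar
    using n minimizer \<mu> strongly_convex fi_differentiable fi_convex by unfold_locales auto
  interpret prob_space M by (rule M)
  interpret free_svrg_run f n \<mu> Lmax xstar M m \<alpha> x0 J
    using m draws L_pos by unfold_locales (auto simp: \<alpha>)
  have sq_dist: "sq_dist s = (\<lambda>\<omega>. (norm (outer_iterate s \<omega> - xstar))\<^sup>2)" for s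
    by (simp add: sq_dist_def outer_iterate_def)
  have \<phi>0_lyapunov: "\<phi>0 = lyapunov x0 x0" by (simp add: \<phi>0 lyapunov_def)
  hence \<phi>0_nonneg: "\<phi>0 \<ge> 0" using sq_dist_le_lyapunov[of x0 x0] by (smt (verit) zero_le_power2)
  have reached: "(\<integral>\<omega>. sq_dist s \<omega> \<partial>M) \<le> \<epsilon> * \<phi>0"
    if "total_complexity n Lmax \<mu> m \<epsilon> \<le> real (gradient_evals n m s)" for s
  proof -
    define c where "c = real n + 2 * real m"
    have c: "c > 0" using m by (simp add: c_def)
    (* The cost n + 2 * m of an outer iteration cancels against the factor n / m + 2. *)
    have "max (3 * Lmax / \<mu>) (real m) = real m / 2 * max (1 / (\<alpha> * \<mu> * real m)) 2"
      using m mu_pos L_pos by (simp add: \<alpha> max_mult_distrib_left)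
    hence "total_complexity n Lmax \<mu> m \<epsilon> = c * (max (1 / (\<alpha> * \<mu> * real m)) 2 * ln (1 / \<epsilon>))"
      using m by (simp add: total_complexity_def c_def field_simps)
    hence "real s \<ge> max (1 / (\<alpha> * \<mu> * real m)) 2 * ln (1 / \<epsilon>)"
      using that c mult_le_cancel_left_pos[OF c] by (simp add: gradient_evals_def c_def mult.commute)
    hence "rate ^ s * \<phi>0 \<le> \<epsilon> * \<phi>0"
      using rate_power_le \<epsilon> \<phi>0_nonneg by (intro mult_right_mono) auto
    thus ?thesis using expectation_sq_dist_le[of s] by (simp add: sq_dist \<phi>0_lyapunov)
  qed
  have "2 * (real n / real m + 2) * max (3 * (Lmax / \<mu>)) (real m) \<le> 18 * (real n + Lmax / \<mu>)"
    using n m L_pos mu_pos m_range by (intro complexity_factor_le) auto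
  hence bound: "total_complexity n Lmax \<mu> m \<epsilon> \<le> 18 * (real n + Lmax / \<mu>) * ln (1 / \<epsilon>)"
    unfolding total_complexity_def using \<epsilon> by (intro mult_right_mono) auto
  show ?thesis
    using integrable_outer_state[of "\<lambda>x w. (norm (x - xstar))\<^sup>2"] reached bound by (auto simp: sq_dist)
qed

end
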